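(* Let $\ell>2$ be an odd prime. For all $A,B\in\mathbb F_\ell^*$ with $A\neq B$, $$|K(A,B)+1|\le 2\sqrt{\ell}.$$
   Context: $\chi$ denotes the Legendre symbol modulo $\ell$ on $\mathbb F_\ell$, with $\chi(0)=0$, and $K(A,B)=\sum_{z\in\mathbb F_\ell}\chi\bigl((z^2-A)(z^2-B)\bigr)$. *)

theory Defs
  imports Complex_Main "HOL-Number_Theory.Number_Theory"
begin

(* The elements of F_l are represented by integers. Since Legendre a l depends only on
   the residue class of a modulo l, K l A B depends only on the classes of A and B, and
   {0..<l} is a complete system of representatives for the summation variable. *)
definition K :: "nat \<Rightarrow> int \<Rightarrow> int \<Rightarrow> int" where
  "K l A B = (\<Sum>z\<in>{0..<int l}. Legendre ((z\<^sup>2 - A) * (z\<^sup>2 - B)) (int l))"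

end

theory Submission
  imports Defs "Berlekamp_Zassenhaus.Finite_Field" "HOL-Computational_Algebra.Polynomial_Factorial"
begin

text \<open>
  Grouping the summation variable \<open>z\<close> by its square turns \<open>K l A B + 1\<close> into the sum
  \<open>S = (\<Sum>x. \<chi> (x * (x - A) * (x - B)))\<close> of the quadratic character \<open>\<chi>\<close> (\<open>sum_quartic_eq_sum_cubic\<close>).
  The bound \<open>\<bar>S\<bar> \<le> 2 * sqrt l\<close> is Hasse's theorem for the elliptic curve \<open>y\<^sup>2 = x * (x - A) * (x - B)\<close>. The
  proof follows Manin's elementary argument, in a form that avoids the group law and gets by with
  upper bounds for the heights beyond the initial one.

  Write \<open>F\<close> for the cubic, \<open>q\<close> for the number of elements of the field, and \<open>X\<close> for the polynomial
  variable. On the twisted curve \<open>F(X) * y\<^sup>2 = F(x)\<close> over the rational functions in \<open>X\<close> lie the points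
  \<open>P = (X, 1)\<close> and \<open>Q = (X ^ q, F ^ ((q - 1) div 2))\<close>. Let \<open>h n\<close> be the height of the abscissa of
  \<open>Q + n * P\<close>, that is, the larger one of the degrees of its numerator and denominator in lowest terms.
  The abscissas of \<open>Q + (n - 1) * P\<close> and \<open>Q + (n + 1) * P\<close> are the two roots of a quadratic equation whose
  coefficients are polynomials of degree at most \<open>2 * h n + 2\<close>. By Gauss's lemma this gives
  \<open>h (n - 1) + h (n + 1) \<le> 2 * h n + 2\<close> (\<open>linked_step\<close>). The recursion
  runs on this equation alone, which is symmetric in the two neighbours: the previous abscissa is one
  root, and the next one is the other root.

  Moreover \<open>h 0 = q\<close>, and cancellation at the elements of the field gives \<open>h n \<le> q + 1 + n * S\<close> for the
  two neighbours \<open>n = 1\<close> and \<open>n = - 1\<close>, up to the choice of the sign of \<open>P\<close> (\<open>first_step\<close>). By induction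
  \<open>0 \<le> h n \<le> n\<^sup>2 + S * n + q\<close> for all integers \<open>n\<close> (\<open>linked_chain\<close>). A quadratic polynomial that is
  nonnegative at all integers has a discriminant of at most 1, and as \<open>q\<close> is odd, \<open>S\<^sup>2 \<le> 4 * q\<close>
  (\<open>discriminant_bound\<close>).
\<close>

section \<open>Heights and roots of quadratic equations\<close>

text \<open>
  The height of the rational function \<open>f / g\<close>, for \<open>f\<close> and \<open>g\<close> coprime. The pair \<open>(f, g)\<close> stands for
  a point of the projective line over the field of rational functions, so \<open>g = 0\<close> is the point at
  infinity, and no step below has to exclude it.
\<close>

definition height :: "'a::zero poly \<Rightarrow> 'a poly \<Rightarrow> nat" where
  "height f g = max (degree f) (degree g)"

lemma coeff_mult_top:
  fixes f g :: "'a::comm_semiring_0 poly"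
  assumes "degree f \<le> m" "degree g \<le> n"
  shows "coeff (f * g) (m + n) = coeff f m * coeff g n"
proof (cases "degree f = m \<and> degree g = n")
  case True
  then show ?thesis using coeff_mult_degree_sum[of f g] by simp
next
  case False
  with assms have "degree f < m \<or> degree g < n" and "degree (f * g) < m + n"
    using degree_mult_le[of f g] by linarith+
  then show ?thesis by (auto simp: coeff_eq_0)
qed

lemma height_coeff_nonzero:
  assumes "f \<noteq> 0 \<or> g \<noteq> 0"
  shows "coeff f (height f g) \<noteq> 0 \<or> coeff g (height f g) \<noteq> 0"
proof (cases "degree f \<le> degree g \<and> g \<noteq> 0")
  case True
  then show ?thesis by (simp add: height_def max_def)
next
  case False
  with assms have "f \<noteq> 0" "degree g \<le> degree f" by auto
  then show ?thesis by (simp add: height_def max_def)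
qed

lemma reduced_fraction:
  fixes f g :: "'a::field_gcd poly"
  assumes "f \<noteq> 0 \<or> g \<noteq> 0"
  obtains c u v where "c \<noteq> 0" "f = c * u" "g = c * v" "coprime u v" "height u v \<le> height f g"
proof -
  obtain u v where "f = u * gcd f g" "g = v * gcd f g" "coprime u v"
    using assms gcd_coprime_exists[of f g] by auto
  then have *: "f = gcd f g * u" "g = gcd f g * v" "coprime u v" by (simp_all only: mult.commute)
  have c: "gcd f g \<noteq> 0" using assms by simp
  have "degree p \<le> degree (gcd f g * p)" for p
    using c by (cases "p = 0") (auto simp: degree_mult_eq)
  from this[of u] this[of v] have "height u v \<le> height f g"
    unfolding height_def *(1)[symmetric] *(2)[symmetric] by (rule max.mono)
  with c * show ?thesis by (rule that)
qed

text \<open>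
  This is the factorisation
  \<open>c0 * U\<^sup>2 - c1 * U * V + c2 * V\<^sup>2 = (g * U - f * V) * (\<alpha> * U - \<beta> * V)\<close> over the ring of polynomials
  itself (Gauss's lemma): \<open>g\<close> divides \<open>c0\<close> and \<open>f\<close> divides \<open>c2\<close> because \<open>f\<close> and \<open>g\<close> are coprime. If both
  are nonzero, the equation determines \<open>c1\<close>; otherwise the nonzero one is a unit, and one of the
  cofactors is still free and can be adapted to \<open>c1\<close>.
\<close>

lemma split_off_root:
  fixes f g c0 c1 c2 :: "'a::field_gcd poly"
  assumes cop: "coprime f g"
    and root: "c0 * f\<^sup>2 - c1 * (f * g) + c2 * g\<^sup>2 = 0"
  obtains \<alpha> \<beta> where "c0 = g * \<alpha>" "c1 = f * \<alpha> + g * \<beta>" "c2 = f * \<beta>"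
proof -
  have "c0 * f\<^sup>2 = g * (c1 * f - c2 * g)" "c2 * g\<^sup>2 = f * (c1 * g - c0 * f)"
    using root by (auto simp: algebra_simps power2_eq_square)
  then have "g dvd c0 * f\<^sup>2" "f dvd c2 * g\<^sup>2" by (metis dvd_triv_left)+
  then have "g dvd c0" "f dvd c2"
    using cop by (auto simp: coprime_dvd_mult_left_iff coprime_commute)
  then obtain \<alpha> \<beta> where ab: "c0 = g * \<alpha>" "c2 = f * \<beta>" by (auto elim!: dvdE)
  have prod: "f * g * (c1 - (f * \<alpha> + g * \<beta>)) = 0"
    using root unfolding ab by (simp add: algebra_simps power2_eq_square)
  show ?thesis
  proof (cases "f = 0 \<or> g = 0")
    case False
    with prod have "c1 = f * \<alpha> + g * \<beta>" by simp
    with ab that show ?thesis by blast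
  next
    case True
    then show ?thesis
    proof
      assume "f = 0"
      with cop have "g dvd c1" by (metis coprime_0_left_iff unit_imp_dvd)
      then obtain k where "c1 = g * k" by (auto elim!: dvdE)
      with ab \<open>f = 0\<close> show ?thesis by (intro that[of \<alpha> k]) auto
    next
      assume "g = 0"
      with cop have "f dvd c1" by (metis coprime_0_right_iff unit_imp_dvd)
      then obtain k where "c1 = f * k" by (auto elim!: dvdE)
      with ab \<open>g = 0\<close> show ?thesis by (intro that[of k \<beta>]) auto
    qed
  qed
qed

text \<open>
  The other root is \<open>\<beta> / \<alpha>\<close> in the factorisation above. The heights of the two linear factors add up
  to the largest degree among the coefficients of the product, since at the top degree the product of
  two nonzero linear forms over the field of constants is nonzero. Reducing \<open>\<beta> / \<alpha>\<close> to lowest terms can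
  only lower its height.
\<close>

lemma residual_root:
  fixes f g c0 c1 c2 :: "'a::field_gcd poly"
  assumes cop: "coprime f g"
    and root: "c0 * f\<^sup>2 - c1 * (f * g) + c2 * g\<^sup>2 = 0"
    and nz: "\<not> (c0 = 0 \<and> c1 = 0 \<and> c2 = 0)"
    and deg: "degree c0 \<le> d" "degree c1 \<le> d" "degree c2 \<le> d"
  obtains u v where "coprime u v" "c0 * u\<^sup>2 - c1 * (u * v) + c2 * v\<^sup>2 = 0"
    "height f g + height u v \<le> d"
proof -
  obtain \<alpha> \<beta> where c: "c0 = g * \<alpha>" "c1 = f * \<alpha> + g * \<beta>" "c2 = f * \<beta>"
    using split_off_root[OF cop root] .
  have "\<beta> \<noteq> 0 \<or> \<alpha> \<noteq> 0" using nz c by auto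
  then obtain k u v where k: "\<beta> = k * u" "\<alpha> = k * v" "coprime u v" "height u v \<le> height \<beta> \<alpha>"
    by (rule reduced_fraction)
  have "c0 * u\<^sup>2 - c1 * (u * v) + c2 * v\<^sup>2 = 0"
    unfolding c k by (simp add: algebra_simps power2_eq_square)
  moreover have "height f g + height \<beta> \<alpha> \<le> d"
  proof (rule ccontr)
    define m n where "m = height f g" and "n = height \<beta> \<alpha>"
    assume "\<not> ?thesis"
    (* In degree m + n the coefficients of the product are those of the product of the two forms made
       of the coefficients of f, g in degree m and of \<beta>, \<alpha> in degree n. *)
    then have big: "d < m + n" by (simp add: m_def n_def)
    have "degree f \<le> m" "degree g \<le> m" "degree \<alpha> \<le> n" "degree \<beta> \<le> n"
      by (simp_all add: m_def n_def height_def)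
    then have "coeff c0 (m + n) = coeff g m * coeff \<alpha> n"
        "coeff c1 (m + n) = coeff f m * coeff \<alpha> n + coeff g m * coeff \<beta> n"
        "coeff c2 (m + n) = coeff f m * coeff \<beta> n"
      unfolding c by (simp_all add: coeff_mult_top)
    moreover have "coeff c0 (m + n) = 0" "coeff c1 (m + n) = 0" "coeff c2 (m + n) = 0"
      using deg big by (auto intro!: coeff_eq_0)
    moreover have "coeff f m \<noteq> 0 \<or> coeff g m \<noteq> 0"
      using cop unfolding m_def by (intro height_coeff_nonzero) auto
    moreover have "coeff \<beta> n \<noteq> 0 \<or> coeff \<alpha> n \<noteq> 0"
      using \<open>\<beta> \<noteq> 0 \<or> \<alpha> \<noteq> 0\<close> unfolding n_def by (rule height_coeff_nonzero)
    ultimately show False by auto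
  qed
  ultimately show ?thesis using k(3,4) by (intro that[of u v]) auto
qed

section \<open>Manin's recursion\<close>

text \<open>
  The relation between the abscissas \<open>t\<close>, \<open>f / g\<close> and \<open>u / v\<close> of three points on
  \<open>y\<^sup>2 = x\<^sup>3 + a * x\<^sup>2 + b * x\<close> whose sum, for a suitable choice of signs, is zero, with denominators
  cleared. It is quadratic in each abscissa and symmetric in the three of them. The form chosen here
  displays the symmetry between \<open>f / g\<close> and \<open>u / v\<close>.
\<close>

definition linked :: "'a::comm_ring_1 \<Rightarrow> 'a \<Rightarrow> 'a \<Rightarrow> 'a \<Rightarrow> 'a \<Rightarrow> 'a \<Rightarrow> 'a \<Rightarrow> bool" where
  "linked a b t f g u v \<longleftrightarrow>
     (f * u - b * g * v)\<^sup>2 + t\<^sup>2 * (f * v - g * u)\<^sup>2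
     - 2 * t * (f * v + g * u) * (f * u + b * g * v) - 4 * a * t * (f * g) * (u * v) = 0"

lemma linked_commute: "linked a b t f g u v \<longleftrightarrow> linked a b t u v f g"
  unfolding linked_def by (simp add: ac_simps power2_commute[of "f * v"])

text \<open>
  For fixed \<open>t\<close> and \<open>f / g\<close>, the two solutions \<open>u / v\<close> are the abscissas of \<open>Q + P\<close> and \<open>Q - P\<close>, where
  \<open>P\<close> and \<open>Q\<close> have the abscissas \<open>t\<close> and \<open>f / g\<close>.
\<close>

lemma linked_quadratic:
  "linked a b t f g u v \<longleftrightarrow>
     (f - t * g)\<^sup>2 * u\<^sup>2
     - 2 * ((f + t * g) * (t * f + b * g) + 2 * a * t * f * g) * (u * v)
     + (t * f - b * g)\<^sup>2 * v\<^sup>2 = 0"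
proof -
  have "(f * u - b * g * v)\<^sup>2 + t\<^sup>2 * (f * v - g * u)\<^sup>2
     - 2 * t * (f * v + g * u) * (f * u + b * g * v) - 4 * a * t * (f * g) * (u * v) =
     (f - t * g)\<^sup>2 * u\<^sup>2
     - 2 * ((f + t * g) * (t * f + b * g) + 2 * a * t * f * g) * (u * v)
     + (t * f - b * g)\<^sup>2 * v\<^sup>2"
    by (simp add: power2_eq_square algebra_simps)
  then show ?thesis by (simp add: linked_def)
qed
text \<open>
  One step along the sequence of abscissas of \<open>Q + n * P\<close>, where \<open>P\<close> has the abscissa \<open>[:0, 1:]\<close>: the
  predecessor \<open>f / g\<close> of \<open>f' / g'\<close> is one root of the quadratic equation for the neighbours of
  \<open>f' / g'\<close>, and the successor is the other one. The coefficients of this equation are quadratic in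
  \<open>f'\<close>, \<open>g'\<close> and in \<open>[:0, 1:]\<close>, whence the bound \<open>2 * height f' g' + 2\<close>. Addition of points and
  ordinates are thereby avoided altogether.
\<close>

lemma linked_step:
  fixes f g f' g' :: "'a::field_gcd poly"
  assumes cop: "coprime f g" "coprime f' g'"
    and link: "linked [:a:] [:b:] [:0, 1:] f g f' g'"
  obtains f'' g'' where "coprime f'' g''" "linked [:a:] [:b:] [:0, 1:] f' g' f'' g''"
    "height f g + height f'' g'' \<le> 2 * height f' g' + 2"
proof -
  define t where "t = [:0, 1 :: 'a:]"
  let ?h = "height f' g'"
  define c0 where "c0 = (f' - t * g')\<^sup>2"
  define c1 where "c1 = 2 * ((f' + t * g') * (t * f' + [:b:] * g') + 2 * [:a:] * t * f' * g')"
  define c2 where "c2 = (t * f' - [:b:] * g')\<^sup>2"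
  have deg: "degree f' \<le> ?h" "degree g' \<le> ?h" by (simp_all add: height_def)
  have t: "degree (t * p) \<le> Suc ?h" if "degree p \<le> ?h" for p
    using that by (simp add: t_def)
  have const: "degree ([:c:] * p) \<le> Suc ?h" if "degree p \<le> ?h" for c p
    using that degree_smult_le[of c p] by simp
  have twice: "degree (p * r) \<le> 2 * ?h + 2" if "degree p \<le> Suc ?h" "degree r \<le> Suc ?h" for p r
    using that degree_mult_le[of p r] by linarith
  have lin: "degree (f' - t * g') \<le> Suc ?h" "degree (f' + t * g') \<le> Suc ?h"
    "degree (t * f' + [:b:] * g') \<le> Suc ?h" "degree (t * f' - [:b:] * g') \<le> Suc ?h"
    by (intro degree_add_le degree_diff_le le_SucI[OF deg(1)] t const deg)+
  have "degree c0 \<le> 2 * ?h + 2" "degree c2 \<le> 2 * ?h + 2"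
    unfolding c0_def c2_def power2_eq_square by (rule twice; rule lin)+
  moreover have "degree c1 \<le> 2 * ?h + 2"
  proof -
    have "c1 = 2 * ((f' + t * g') * (t * f' + [:b:] * g') + (t * f') * ([:2 * a:] * g'))"
      by (simp add: c1_def numeral_poly algebra_simps)
    moreover have "degree \<dots> \<le> 2 * ?h + 2"
      using degree_add_le[OF twice[OF lin(2,3)] twice[OF t[OF deg(1)] const[OF deg(2)]]]
      by (simp only: mult_2[of "_ + _"] degree_add_le)
    ultimately show ?thesis by simp
  qed
  moreover have "\<not> (c0 = 0 \<and> c1 = 0 \<and> c2 = 0)"
  proof
    assume "c0 = 0 \<and> c1 = 0 \<and> c2 = 0"
    then have eq: "f' = t * g'" "t * f' = [:b:] * g'" by (auto simp: c0_def c2_def)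
    then have "(t * t - [:b:]) * g' = 0" by (simp add: algebra_simps)
    moreover have "t * t - [:b:] \<noteq> 0" by (simp add: t_def)
    ultimately have "g' = 0" by simp
    with eq have "f' = 0" by simp
    with \<open>g' = 0\<close> cop show False by simp
  qed
  moreover have "c0 * f\<^sup>2 - c1 * (f * g) + c2 * g\<^sup>2 = 0"
    using linked_commute[THEN iffD1, OF link] unfolding linked_quadratic c0_def c1_def c2_def t_def .
  ultimately obtain u v where "coprime u v" "c0 * u\<^sup>2 - c1 * (u * v) + c2 * v\<^sup>2 = 0"
    "height f g + height u v \<le> 2 * ?h + 2"
    using residual_root[OF cop(1), of c0 c1 c2 "2 * ?h + 2"] by blast
  then show ?thesis
    by (intro that[of u v]) (simp_all only: linked_quadratic c0_def c1_def c2_def t_def)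
qed

text \<open>
  By the previous lemma the differences of successive heights grow by at most 2 per step. If the first
  difference is at most \<open>1 + s\<close>, the \<open>n\<close>-th height is at most
  \<open>height f\<^sub>0 g\<^sub>0 + n * (1 + s) + n * (n - 1)\<close>, and it is never negative.
\<close>

lemma linked_chain:
  fixes f\<^sub>0 g\<^sub>0 f\<^sub>1 g\<^sub>1 :: "'a::field_gcd poly" and s :: int
  assumes "coprime f\<^sub>0 g\<^sub>0" "coprime f\<^sub>1 g\<^sub>1" "linked [:a:] [:b:] [:0, 1:] f\<^sub>0 g\<^sub>0 f\<^sub>1 g\<^sub>1"
    and "int (height f\<^sub>1 g\<^sub>1) \<le> int (height f\<^sub>0 g\<^sub>0) + 1 + s"
  shows "0 \<le> int (height f\<^sub>0 g\<^sub>0) + int n * s + (int n)\<^sup>2"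
proof -
  let ?q = "int (height f\<^sub>0 g\<^sub>0)"
  have "\<exists>f g f' g'. coprime f g \<and> coprime f' g' \<and> linked [:a:] [:b:] [:0, 1:] f g f' (g' :: 'a poly) \<and>
      int (height f' g') \<le> int (height f g) + 1 + s + 2 * int n \<and>
      int (height f g) \<le> ?q + int n * s + (int n)\<^sup>2"
  proof (induction n)
    case 0
    show ?case
      by (rule exI[of _ f\<^sub>0], rule exI[of _ g\<^sub>0], rule exI[of _ f\<^sub>1], rule exI[of _ g\<^sub>1]) (use assms in simp)
  next
    case (Suc n)
    then obtain f g f' g' where *: "coprime f g" "coprime f' (g' :: 'a poly)" "linked [:a:] [:b:] [:0, 1:] f g f' g'"
      and h: "int (height f' g') \<le> int (height f g) + 1 + s + 2 * int n"
        "int (height f g) \<le> ?q + int n * s + (int n)\<^sup>2" by blast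
    from * obtain f'' g'' where **: "coprime f'' g''" "linked [:a:] [:b:] [:0, 1:] f' g' f'' g''"
      and step: "height f g + height f'' g'' \<le> 2 * height f' g' + 2" by (rule linked_step)
    have "int (height f'' g'') \<le> int (height f' g') + 1 + s + 2 * int (Suc n)"
      using step h(1) by (simp add: algebra_simps)
    moreover have "int (height f' g') \<le> ?q + int (Suc n) * s + (int (Suc n))\<^sup>2"
      using h by (simp add: power2_eq_square algebra_simps)
    ultimately show ?case
      by (intro exI[of _ f'] exI[of _ g'] exI[of _ f''] exI[of _ g''] conjI *(2) **)
  qed
  then obtain f g :: "'a poly" where "int (height f g) \<le> ?q + int n * s + (int n)\<^sup>2" by blast
  then show ?thesis by linarith
qed

text \<open>
  Nonnegativity of \<open>x\<^sup>2 + s * x + q\<close> at all integers leaves room for two real roots within an interval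
  between consecutive integers. Evaluation at the integer nearest to the vertex gives
  \<open>s\<^sup>2 \<le> 4 * q\<close> for even \<open>s\<close> and \<open>s\<^sup>2 \<le> 4 * q + 1\<close> for odd \<open>s\<close>. Equality in the latter would make \<open>q\<close>
  the product of two consecutive integers, hence even.
\<close>

lemma discriminant_bound:
  fixes q s :: int
  assumes "odd q" "\<And>n::nat. 0 \<le> q + int n * s + (int n)\<^sup>2" "\<And>n::nat. 0 \<le> q - int n * s + (int n)\<^sup>2"
  shows "s\<^sup>2 \<le> 4 * q"
proof -
  define m where "m = nat (\<bar>s\<bar> div 2)"
  have le: "0 \<le> q - int m * \<bar>s\<bar> + (int m)\<^sup>2"
    using assms(2,3)[of m] by (simp add: abs_if)
  consider "\<bar>s\<bar> = 2 * int m" | "\<bar>s\<bar> = 2 * int m + 1" unfolding m_def by linarith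
  then show ?thesis
  proof cases
    case 1
    then have "s\<^sup>2 = (2 * int m)\<^sup>2" by (metis power2_abs)
    with le 1 show ?thesis by (simp add: power2_eq_square algebra_simps)
  next
    case 2
    then have s2: "s\<^sup>2 = (2 * int m + 1)\<^sup>2" by (metis power2_abs)
    have "q \<noteq> int m * (int m + 1)" using \<open>odd q\<close> by auto
    with le 2 have "int m * (int m + 1) < q" by (simp add: power2_eq_square algebra_simps)
    with s2 show ?thesis by (simp add: power2_eq_square algebra_simps)
  qed
qed

section \<open>The quadratic character of a finite field\<close>

lemma two_neq_0_if_odd_card:
  assumes "odd CARD('a)"
  shows "(2 :: 'a::finite_field) \<noteq> 0"
proof
  assume "(2 :: 'a) = 0"
  then have "of_nat 2 = (0 :: 'a)" by simp
  then have "CHAR('a) dvd 2" by (simp only: of_nat_eq_0_iff_char_dvd)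
  moreover have "CHAR('a) \<noteq> 1" by simp
  ultimately have "CHAR('a) = 2" using prime_nat_iff two_is_prime_nat by blast
  with CHAR_dvd_CARD[where ?'a = 'a] assms show False by simp
qed

lemma power_card_minus_1:
  assumes "(x :: 'a::finite_field) \<noteq> 0"
  shows "x ^ (CARD('a) - 1) = 1"
proof -
  have "x * x ^ (CARD('a) - 1) = x"
    using finite_field_power_card_eq_same[of x] by (simp flip: power_Suc)
  with assms show ?thesis by simp
qed

definition quad_char :: "'a::field \<Rightarrow> int" where
  "quad_char x = (if x = 0 then 0 else if \<exists>y. y\<^sup>2 = x then 1 else - 1)"

lemma quad_char_cases: "quad_char x = 0 \<or> quad_char x = 1 \<or> quad_char x = - 1"
  by (simp add: quad_char_def)

lemma quad_char_0 [simp]: "quad_char 0 = 0"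
  by (simp add: quad_char_def)

lemma quad_char_eq_0_iff [simp]: "quad_char x = 0 \<longleftrightarrow> x = 0"
  by (simp add: quad_char_def)

lemma quad_char_1 [simp]: "quad_char 1 = 1"
  by (auto simp: quad_char_def intro: exI[of _ 1])

lemma quad_char_square_mult:
  assumes "c \<noteq> 0"
  shows "quad_char (c\<^sup>2 * x) = quad_char x"
proof -
  have "(\<exists>y. y\<^sup>2 = c\<^sup>2 * x) \<longleftrightarrow> (\<exists>y. y\<^sup>2 = x)"
  proof
    assume "\<exists>y. y\<^sup>2 = c\<^sup>2 * x"
    then obtain y where "y\<^sup>2 = c\<^sup>2 * x" ..
    with assms have "(y / c)\<^sup>2 = x" by (simp add: power_divide)
    then show "\<exists>y. y\<^sup>2 = x" ..
  next
    assume "\<exists>y. y\<^sup>2 = x"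
    then obtain y where "y\<^sup>2 = x" ..
    then have "(c * y)\<^sup>2 = c\<^sup>2 * x" by (simp add: power_mult_distrib)
    then show "\<exists>y. y\<^sup>2 = c\<^sup>2 * x" ..
  qed
  with assms show ?thesis by (simp add: quad_char_def)
qed

lemma card_square_roots:
  assumes "(2 :: 'a::field) \<noteq> 0"
  shows "int (card {z :: 'a. z\<^sup>2 = x}) = 1 + quad_char x"
proof (cases "\<exists>y. y\<^sup>2 = x")
  case True
  then obtain y where y: "y\<^sup>2 = x" ..
  then have roots: "{z. z\<^sup>2 = x} = {y, - y}" by (auto simp: power2_eq_iff)
  show ?thesis
  proof (cases "y = 0")
    case False
    with assms have "y + y \<noteq> 0" by (simp flip: mult_2)
    then have "y \<noteq> - y" by (simp add: eq_neg_iff_add_eq_0)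
    with roots y False show ?thesis by (auto simp: quad_char_def)
  qed (use roots y in simp)
next
  case False
  then have "x \<noteq> 0" "{z. z\<^sup>2 = x} = {}" by (auto intro: exI[of _ 0])
  with False show ?thesis by (auto simp: quad_char_def)
qed

lemma sum_over_squares:
  fixes g :: "'a::{field,finite} \<Rightarrow> int"
  assumes "(2 :: 'a) \<noteq> 0"
  shows "(\<Sum>z\<in>UNIV. g (z\<^sup>2)) = (\<Sum>x\<in>UNIV. (1 + quad_char x) * g x)"
proof -
  have "(\<Sum>z\<in>UNIV. g (z\<^sup>2)) = (\<Sum>x\<in>UNIV. \<Sum>z\<in>{z. z\<^sup>2 = x}. g (z\<^sup>2))"
    using sum.group[of UNIV UNIV "\<lambda>z. z\<^sup>2" "\<lambda>z. g (z\<^sup>2)"] by simp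
  also have "\<dots> = (\<Sum>x\<in>UNIV. (1 + quad_char x) * g x)"
    by (rule sum.cong) (simp_all flip: card_square_roots[OF assms])
  finally show ?thesis .
qed

lemma sum_quad_char:
  assumes "(2 :: 'a::{field,finite}) \<noteq> 0"
  shows "(\<Sum>x\<in>(UNIV :: 'a set). quad_char x) = 0"
  using sum_over_squares[OF assms, of "\<lambda>_. 1"] by (simp add: sum.distrib)

text \<open>
  Every nonzero \<open>x\<close> satisfies \<open>x ^ e = 1\<close> or \<open>x ^ e = - 1\<close> with \<open>e = (CARD('a) - 1) div 2\<close>. The nonzero
  squares satisfy the former, and there are \<open>e\<close> of them because the character sums to 0. A nonsquare
  with the same property would be one root too many for a polynomial of degree \<open>e\<close>.
\<close>

lemma euler_criterion_finite_field:
  fixes x :: "'a::finite_field"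
  assumes "odd CARD('a)"
  shows "of_int (quad_char x) = x ^ ((CARD('a) - 1) div 2)"
proof -
  define e where "e = (CARD('a) - 1) div 2"
  have two: "(2 :: 'a) \<noteq> 0" using assms by (rule two_neq_0_if_odd_card)
  have card: "CARD('a) - 1 = e + e"
    using assms unfolding e_def by presburger
  have "card {0, 1 :: 'a} \<le> CARD('a)" by (rule card_mono) auto
  with card have "e \<noteq> 0" by auto
  have square: "y\<^sup>2 ^ e = 1" if "y \<noteq> 0" for y :: 'a
    using power_card_minus_1[OF that] card by (simp add: power_add power_mult_distrib power2_eq_square)
  have "x ^ e = -1" if "x \<noteq> 0" "\<nexists>y. y\<^sup>2 = x"
  proof (rule ccontr)
    assume "x ^ e \<noteq> -1"
    moreover have "(x ^ e)\<^sup>2 = 1"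
      using square[OF \<open>x \<noteq> 0\<close>] by (simp add: power2_eq_square power_mult_distrib)
    ultimately have "x ^ e = 1" by (auto simp: power2_eq_1_iff)
    define Q N where "Q = {y :: 'a. quad_char y = 1}" and "N = {y :: 'a. quad_char y = -1}"
    have "UNIV = insert 0 (Q \<union> N)" using quad_char_cases by (auto simp: Q_def N_def)
    moreover have "0 \<notin> Q \<union> N" "Q \<inter> N = {}" by (auto simp: Q_def N_def)
    ultimately have "CARD('a) = Suc (card Q + card N)"
      by (metis card_Un_disjoint card_insert_disjoint finite)
    moreover have "(\<Sum>y\<in>(UNIV :: 'a set). quad_char y) = int (card Q) - int (card N)"
    proof -
      have "quad_char y = of_bool (y \<in> Q) - of_bool (y \<in> N)" for y :: 'a
        using quad_char_cases[of y] by (auto simp: Q_def N_def)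
      then show ?thesis by (simp add: sum_subtractf)
    qed
    ultimately have "card Q = e" using sum_quad_char[OF two] card by simp
    have "y ^ e = 1" if "y \<in> Q" for y
      using that square by (auto simp: Q_def quad_char_def split: if_splits)
    with \<open>x ^ e = 1\<close> have "insert x Q \<subseteq> {y. poly (monom 1 e - 1) y = 0}"
      by (auto simp: poly_monom)
    then have "card (insert x Q) \<le> card {y :: 'a. poly (monom 1 e - 1) y = 0}"
      by (intro card_mono) auto
    also have nz: "monom 1 e - 1 \<noteq> (0 :: 'a poly)"
      using \<open>e \<noteq> 0\<close> by (auto simp: monom_eq_1_iff)
    have "card {y :: 'a. poly (monom 1 e - 1) y = 0} \<le> degree (monom 1 e - 1 :: 'a poly)"
      by (rule card_poly_roots_bound) fact
    also have "\<dots> \<le> e" by (intro degree_diff_le) (simp_all add: degree_monom_le)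
    finally have "card (insert x Q) \<le> e" .
    moreover have "x \<notin> Q" using that by (auto simp: Q_def quad_char_def)
    ultimately show False using \<open>card Q = e\<close> by simp
  qed
  with square \<open>e \<noteq> 0\<close> show ?thesis
    unfolding e_def[symmetric] by (auto simp: quad_char_def)
qed

lemma quad_char_mult:
  fixes x y :: "'a::finite_field"
  assumes "odd CARD('a)"
  shows "quad_char (x * y) = quad_char x * quad_char y"
proof -
  have "(1 :: 'a) \<noteq> - 1"
    using two_neq_0_if_odd_card[OF assms] by (simp add: eq_neg_iff_add_eq_0)
  moreover have "(of_int (quad_char (x * y)) :: 'a) = of_int (quad_char x * quad_char y)"
    by (simp add: euler_criterion_finite_field[OF assms] power_mult_distrib)
  ultimately show ?thesis
    using quad_char_cases[of x] quad_char_cases[of y] quad_char_cases[of "x * y"]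
    by (auto simp del: quad_char_eq_0_iff)
qed

text \<open>
  Away from \<open>x = b\<close> the product may be replaced by the quotient \<open>(x - a) / (x - b)\<close>, from which it
  differs by a square. This quotient is a Moebius transformation that takes every value except 1
  exactly once.
\<close>

lemma sum_quad_char_quadratic:
  fixes a b :: "'a::{field,finite}"
  assumes "(2 :: 'a) \<noteq> 0" "a \<noteq> b"
  shows "(\<Sum>x\<in>UNIV. quad_char ((x - a) * (x - b))) = - 1"
proof -
  have "quad_char ((x - a) * (x - b)) = quad_char ((x - a) / (x - b))" if "x \<noteq> b" for x
    using quad_char_square_mult[of "x - b" "(x - a) / (x - b)"] that
    by (simp add: power2_eq_square mult.commute)
  then have drop: "(\<Sum>x\<in>UNIV. quad_char ((x - a) * (x - b))) = (\<Sum>x\<in>UNIV - {b}. quad_char ((x - a) / (x - b)))"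
    by (subst sum.remove[of _ b]) auto
  have inverse: "(b + (b - a) / (w - 1) - a) / (b + (b - a) / (w - 1) - b) = w" if "w \<noteq> 1" for w
  proof -
    have "b + (b - a) / (w - 1) - a = (b - a) / (w - 1) * w" using that by (simp add: field_simps)
    with assms(2) that show ?thesis by simp
  qed
  have "(\<Sum>x\<in>UNIV - {b}. quad_char ((x - a) / (x - b))) = (\<Sum>w\<in>UNIV - {1 :: 'a}. quad_char w)"
    by (rule sum.reindex_bij_witness[of _ "\<lambda>w. b + (b - a) / (w - 1)" "\<lambda>x. (x - a) / (x - b)"])
      (use assms(2) inverse in \<open>auto simp: divide_simps\<close>)
  also have "\<dots> = - 1"
    using sum_quad_char[OF assms(1)] by (simp add: sum.remove[of UNIV 1])
  finally show ?thesis using drop by simp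
qed

text \<open>
  The element \<open>x\<close> is the square of \<open>1 + quad_char x\<close> elements \<open>z\<close>. The summand 1 of this multiplicity
  contributes the character sum of a quadratic polynomial, which is \<open>- 1\<close>, and \<open>quad_char x\<close> turns the
  quadratic polynomial into a cubic one.
\<close>

lemma sum_quartic_eq_sum_cubic:
  fixes a b :: "'a::finite_field"
  assumes "odd CARD('a)" "a \<noteq> b"
  shows "(\<Sum>z\<in>UNIV. quad_char ((z\<^sup>2 - a) * (z\<^sup>2 - b))) + 1 =
    (\<Sum>x\<in>UNIV. quad_char (x * (x - a) * (x - b)))"
proof -
  have two: "(2 :: 'a) \<noteq> 0" using assms(1) by (rule two_neq_0_if_odd_card)
  have "(\<Sum>z\<in>UNIV. quad_char ((z\<^sup>2 - a) * (z\<^sup>2 - b)))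
      = (\<Sum>x\<in>UNIV. (1 + quad_char x) * quad_char ((x - a) * (x - b)))"
    by (rule sum_over_squares[OF two])
  also have "\<dots> = (\<Sum>x\<in>UNIV. quad_char ((x - a) * (x - b)))
      + (\<Sum>x\<in>UNIV. quad_char (x * (x - a) * (x - b)))"
    by (simp add: distrib_right sum.distrib mult.assoc quad_char_mult[OF assms(1), of _ "_ * _"])
  finally show ?thesis by (simp add: sum_quad_char_quadratic[OF two assms(2)])
qed

section \<open>The starting point and its neighbours\<close>

lemma linked_scale:
  fixes k :: "'a::idom"
  assumes "k \<noteq> 0"
  shows "linked a b t f g (k * u) (k * v) \<longleftrightarrow> linked a b t f g u v"
proof -
  have "(f * (k * u) - b * g * (k * v))\<^sup>2 + t\<^sup>2 * (f * (k * v) - g * (k * u))\<^sup>2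
     - 2 * t * (f * (k * v) + g * (k * u)) * (f * (k * u) + b * g * (k * v))
     - 4 * a * t * (f * g) * ((k * u) * (k * v))
    = k\<^sup>2 * ((f * u - b * g * v)\<^sup>2 + t\<^sup>2 * (f * v - g * u)\<^sup>2
     - 2 * t * (f * v + g * u) * (f * u + b * g * v) - 4 * a * t * (f * g) * (u * v))"
    by (simp add: power2_eq_square algebra_simps)
  with assms show ?thesis by (simp add: linked_def)
qed

text \<open>
  The quadratic equation for the abscissas of the sum and of the difference of two points, in
  \<open>linked_quadratic\<close>, has as its discriminant 16 times the product of the values of the cubic at the
  abscissas \<open>x\<close> and \<open>y\<close> of these points. The equation can therefore be solved when this product is a
  square.
\<close>

lemma discriminant_identity:
  fixes x y A B :: "'a::comm_ring_1"
  shows "((x + y) * (x * y + A * B) - 2 * (A + B) * x * y)\<^sup>2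
    - 4 * (x * (x - A) * (x - B)) * (y * (y - A) * (y - B)) = (x * y - A * B)\<^sup>2 * (x - y)\<^sup>2"
  by (simp add: power2_eq_square algebra_simps)

text \<open>
  Both sides are monic of degree \<open>CARD('a)\<close> and agree on all of the field. This is the part of the
  Frobenius homomorphism on polynomials that is needed for a cubic that splits into linear factors.
\<close>

lemma linear_power_card:
  fixes c :: "'a::finite_field"
  shows "[:- c, 1:] ^ CARD('a) = monom 1 CARD('a) - [:c:]"
proof (rule poly_eqI_degree_lead_coeff[where n = "CARD('a)" and A = UNIV])
  show "coeff ([:- c, 1:] ^ CARD('a)) CARD('a) = coeff (monom 1 CARD('a) - [:c:]) CARD('a)"
    using coeff_linear_power[of "- c" "CARD('a)"] by (simp add: coeff_pCons split: nat.splits)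
  show "degree ([:- c, 1:] ^ CARD('a)) \<le> CARD('a)"
    by (simp add: degree_linear_power)
  show "degree (monom 1 CARD('a) - [:c:]) \<le> CARD('a)"
    by (intro degree_diff_le) (simp_all add: degree_monom_le)
  show "poly ([:- c, 1:] ^ CARD('a)) z = poly (monom 1 CARD('a) - [:c:]) z" for z
    by (simp add: poly_monom finite_field_power_card_eq_same)
qed simp

lemma coprime_linear_power:
  fixes p :: "'a::field_gcd poly"
  assumes "poly p r \<noteq> 0"
  shows "coprime ([:- r, 1:] ^ m) p"
proof -
  have "coprime [:- r, 1:] p"
    using assms by (intro prime_elem_imp_coprime prime_elem_linear_field_poly) (auto simp: poly_eq_0_iff_dvd)
  then show ?thesis by simp
qed

lemma prod_linear_powers_dvd:
  fixes p :: "'a::field_gcd poly"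
  assumes "finite R" "\<And>r. r \<in> R \<Longrightarrow> [:- r, 1:] ^ m r dvd p"
  shows "(\<Prod>r\<in>R. [:- r, 1:] ^ m r) dvd p"
  using assms
proof (induction R)
  case (insert r R)
  have "coprime ([:- r, 1:] ^ m r) (\<Prod>r\<in>R. [:- r, 1:] ^ m r)"
    using insert.hyps by (intro coprime_linear_power) (auto simp: poly_prod)
  with insert show ?case by (simp add: divides_mult)
qed simp

lemma double_root_dvd:
  fixes p p' :: "'a::field_gcd poly"
  assumes "[:- r, 1:]\<^sup>2 dvd p * p'" "poly p' r \<noteq> 0"
  shows "[:- r, 1:]\<^sup>2 dvd p"
  using assms coprime_linear_power[OF assms(2), of 2] by (simp add: coprime_dvd_mult_left_iff)

text \<open>
  The sequence starts at the Frobenius image of the point with abscissa \<open>X = [:0, 1:]\<close>. Its abscissa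
  \<open>P = X ^ q\<close>, where \<open>q = CARD('a)\<close>, has height \<open>q\<close>. The cubic takes the value \<open>F ^ q\<close> there, and the square
  root \<open>F ^ ((q + 1) div 2)\<close> of \<open>F * F ^ q\<close> makes the quadratic equation for the neighbours solvable: the
  roots are \<open>(M + R) / D\<^sup>2\<close> for the two signs of \<open>R\<close>, with \<open>D = X ^ q - X\<close>. Counting degrees bounds
  their heights by \<open>2 * q + 1\<close>.

  The bound is improved by cancellation at the roots \<open>r\<close> of \<open>D\<close>, which are all the elements of the
  field. At \<open>r\<close> the numerator takes the value \<open>2 * F r * (1 + s * quad_char (F r))\<close>, by Euler's
  criterion. A double factor cancels if the last term of this product vanishes, and a simple factor if
  \<open>F r = 0\<close>; the multiplicity is \<open>1 - s * quad_char (F r)\<close> in all cases. The multiplicities sum to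
  \<open>q - s * S\<close>, and this is how the character sum \<open>S\<close> enters the height.
\<close>

lemma first_step:
  fixes A B :: "'a::{finite_field,field_gcd}" and s :: int
  defines "S \<equiv> (\<Sum>x\<in>UNIV. quad_char (x * (x - A) * (x - B)))"
  assumes odd: "odd CARD('a)" and s: "s = 1 \<or> s = - 1"
  obtains f g where "coprime f g"
    "linked [:- (A + B):] [:A * B:] [:0, 1:] (monom 1 CARD('a)) 1 f g"
    "int (height f g) \<le> int CARD('a) + 1 + s * S"
proof -
  define q e where "q = CARD('a)" and "e = (q - 1) div 2"
  define X P where "X = [:0, 1 :: 'a:]" and "P = monom (1 :: 'a) q"
  define F where "F = X * (X - [:A:]) * (X - [:B:])"
  define M where "M = (P + X) * (P * X + [:A:] * [:B:]) - 2 * ([:A:] + [:B:]) * P * X"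
  define R where "R = of_int s * 2 * F ^ Suc e"
  define N where "N = M + R"
  define D where "D = P - X"
  define m where "m = (\<lambda>r. nat (1 - s * quad_char (poly F r)))"
  have two: "(2 :: 'a) \<noteq> 0" using odd by (rule two_neq_0_if_odd_card)
  have q: "q = Suc (2 * e)" using odd unfolding q_def e_def by presburger
  have eval_PX: "poly P r = r" "poly X r = r" for r
    by (simp_all add: P_def X_def poly_monom q_def finite_field_power_card_eq_same)
  have eval_F: "poly F r = r * (r - A) * (r - B)" for r
    by (simp add: F_def eval_PX)

  have s2: "of_int s * of_int s = (1 :: 'a poly)" using s by auto
  have "[:0, 1:] ^ q = P - [:0:]" "[:- A, 1:] ^ q = P - [:A:]" "[:- B, 1:] ^ q = P - [:B:]"
    using linear_power_card[of "0 :: 'a"] linear_power_card[of A] linear_power_card[of B]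
    by (simp_all add: P_def q_def)
  moreover have F_prod: "F = [:0, 1:] * [:- A, 1:] * [:- B, 1:]"
    by (simp add: F_def X_def)
  ultimately have Fq: "F ^ q = P * (P - [:A:]) * (P - [:B:])"
    by (simp only: F_prod power_mult_distrib) simp
  have "R\<^sup>2 = 4 * (F ^ Suc e * F ^ Suc e)"
    using s2 by (simp add: R_def power2_eq_square algebra_simps)
  also have "F ^ Suc e * F ^ Suc e = F ^ q * F"
  proof -
    have "Suc e + Suc e = Suc q" using q by simp
    then show ?thesis by (simp only: power_add[symmetric] power_Suc2[symmetric])
  qed
  also have "\<dots> = (P * (P - [:A:]) * (P - [:B:])) * (X * (X - [:A:]) * (X - [:B:]))"
    by (simp only: Fq) (simp only: F_def)
  finally have R2: "M\<^sup>2 - R\<^sup>2 = (P * X - [:A:] * [:B:])\<^sup>2 * D\<^sup>2"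
    unfolding M_def D_def discriminant_identity[symmetric] by (simp only: mult.assoc)

  have linked_N: "linked [:- (A + B):] [:A * B:] X P 1 N (D\<^sup>2)"
  proof -
    have middle: "(P + X * 1) * (X * P + [:A * B:] * 1) + 2 * [:- (A + B):] * X * P * 1 = M"
    proof -
      have const: "[:- (A + B):] = - ([:A:] + [:B:])" "[:A * B:] = [:A:] * [:B:]" by simp_all
      have "(P + X * 1) * (X * P + u * 1) + 2 * (- v) * X * P * 1 = (P + X) * (P * X + u) - 2 * v * P * X"
        for u v by (simp add: algebra_simps)
      then show ?thesis unfolding M_def const .
    qed
    have "(P - X * 1)\<^sup>2 * N\<^sup>2 - 2 * M * (N * D\<^sup>2) + (X * P - [:A * B:] * 1)\<^sup>2 * (D\<^sup>2)\<^sup>2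
      = D\<^sup>2 * (R\<^sup>2 - M\<^sup>2 + (P * X - [:A:] * [:B:])\<^sup>2 * D\<^sup>2)"
    proof -
      have "D\<^sup>2 * N\<^sup>2 - 2 * M * (N * D\<^sup>2) + E * (D\<^sup>2)\<^sup>2 = D\<^sup>2 * (R\<^sup>2 - M\<^sup>2 + E * D\<^sup>2)" for E
        by (simp add: N_def power2_eq_square algebra_simps)
      moreover have "[:A * B:] = [:A:] * [:B:]" by simp
      ultimately show ?thesis by (simp only: D_def mult_1_right mult.commute[of X P])
    qed
    also have "\<dots> = 0" using R2 by (simp add: algebra_simps)
    finally show ?thesis unfolding linked_quadratic middle .
  qed

  have eval_M: "poly M r = 2 * poly F r" for r
  proof -
    have "poly M r = (r + r) * (r * r + A * B) - 2 * (A + B) * r * r"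
      by (simp add: M_def eval_PX algebra_simps)
    also have "\<dots> = 2 * (r * (r - A) * (r - B))"
      by (simp add: left_diff_distrib right_diff_distrib distrib_left distrib_right mult_ac)
    finally show ?thesis by (simp only: eval_F)
  qed
  have eval_N: "poly N r = 2 * poly F r * (1 + of_int (s * quad_char (poly F r)))" for r
  proof -
    have "poly R r = 2 * poly F r * of_int (s * quad_char (poly F r))"
      using euler_criterion_finite_field[OF odd, of "poly F r"]
      by (simp add: R_def q_def e_def poly_power)
    then show ?thesis by (simp add: N_def eval_M distrib_left)
  qed
  have D_dvd: "[:- r, 1:]\<^sup>2 dvd D\<^sup>2" for r
  proof -
    have "[:- r, 1:] dvd D" by (simp add: D_def eval_PX flip: poly_eq_0_iff_dvd)
    then show ?thesis by (rule dvd_power_same)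
  qed
  have m_cases: "m r = 0 \<or> m r = 1 \<and> poly F r = 0 \<or> m r = 2 \<and> s * quad_char (poly F r) = - 1" for r
    using s quad_char_cases[of "poly F r"] by (auto simp: m_def)
  have dvd: "[:- r, 1:] ^ m r dvd N" "[:- r, 1:] ^ m r dvd D\<^sup>2" for r
  proof -
    show "[:- r, 1:] ^ m r dvd D\<^sup>2"
      using m_cases[of r] by (intro dvd_trans[OF le_imp_power_dvd D_dvd]) auto
    show "[:- r, 1:] ^ m r dvd N"
      using m_cases[of r]
    proof (elim disjE conjE)
      assume m: "m r = 2" and chi: "s * quad_char (poly F r) = - 1"
      then have "poly F r \<noteq> 0" by auto
      (* The other numerator M - R does not vanish at r, so the double zero of N * (M - R) that comes
         from the factor D^2 is a double zero of N. *)
      have "N * (M - R) = (P * X - [:A:] * [:B:])\<^sup>2 * D\<^sup>2"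
        unfolding R2[symmetric] N_def by (simp add: power2_eq_square algebra_simps)
      with D_dvd[of r] have "[:- r, 1:]\<^sup>2 dvd N * (M - R)" by simp
      moreover have "poly (M - R) r \<noteq> 0"
      proof -
        have "poly N r = 0" using chi by (simp add: eval_N)
        then have "poly (M - R) r = 2 * (2 * poly F r)" using eval_M[of r] by (simp add: N_def algebra_simps)
        with two \<open>poly F r \<noteq> 0\<close> show ?thesis by (simp only: mult_eq_0_iff) simp
      qed
      ultimately show ?thesis unfolding m by (rule double_root_dvd)
    qed (simp_all add: eval_N flip: poly_eq_0_iff_dvd)
  qed

  define G where "G = (\<Prod>r\<in>UNIV. [:- r, 1:] ^ m r)"
  have "G dvd N" "G dvd D\<^sup>2"
    unfolding G_def by (intro prod_linear_powers_dvd dvd; simp)+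
  then obtain N' V where N': "N = G * N'" and V: "D\<^sup>2 = G * V" by (auto elim!: dvdE)
  have degP: "degree P = q" by (simp add: P_def degree_monom_eq)
  have "q > 1"
  proof -
    have "card {0, 1 :: 'a} \<le> CARD('a)" by (rule card_mono) auto
    then show ?thesis by (simp add: q_def)
  qed
  have degD: "degree D = q"
  proof -
    have "degree (- X) < degree P" using \<open>q > 1\<close> by (simp add: degP X_def)
    then have "degree (P + - X) = q" by (simp only: degree_add_eq_left degP)
    then show ?thesis by (simp add: D_def)
  qed
  with \<open>q > 1\<close> have "D \<noteq> 0" by auto
  with V have "G \<noteq> 0" "V \<noteq> 0" by auto
  have degG: "int (degree G) = int q - s * S"
  proof -
    have "degree G = (\<Sum>r\<in>UNIV. m r)"
      unfolding G_def by (subst degree_prod_sum_eq) (simp_all add: degree_linear_power)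
    then have "int (degree G) = (\<Sum>r\<in>UNIV. int (m r))" by simp
    also have "\<dots> = (\<Sum>r\<in>UNIV. 1 - s * quad_char (r * (r - A) * (r - B)))"
    proof (rule sum.cong)
      fix r
      have "s * quad_char (poly F r) \<le> 1"
        using s quad_char_cases[of "poly F r"] by (auto)
      then show "int (m r) = 1 - s * quad_char (r * (r - A) * (r - B))" by (simp add: m_def eval_F)
    qed simp
    also have "\<dots> = int q - s * S" by (simp add: sum_subtractf S_def q_def sum_distrib_left)
    finally show ?thesis .
  qed
  have degN: "degree N \<le> 2 * q + 1"
  proof -
    have X: "degree X \<le> 1" "degree X \<le> q" using \<open>q > 1\<close> by (simp_all add: X_def)
    have lin: "degree (X - [:c:]) \<le> 1" for c by (simp add: X_def)
    have PX: "degree (P * X) \<le> q + 1"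
      using degree_mult_le[of P X] degP X by linarith
    have "degree ((P + X) * (P * X + [:A:] * [:B:])) \<le> q + (q + 1)"
      using degP X PX by (intro order.trans[OF degree_mult_le] add_mono degree_add_le) auto
    moreover have "degree (2 * ([:A:] + [:B:]) * P * X) \<le> q + 1"
    proof -
      have "2 * ([:A:] + [:B:]) * P * X = [:2 * (A + B):] * (P * X)"
        by (simp add: numeral_poly algebra_simps)
      then show ?thesis using PX degree_smult_le[of "2 * (A + B)" "P * X"] by simp
    qed
    ultimately have "degree M \<le> 2 * q + 1"
      unfolding M_def by (intro degree_diff_le) auto
    moreover have "degree R \<le> 2 * q + 1"
    proof -
      have "degree F \<le> 3"
        unfolding F_def using X(1) lin[of A] lin[of B]
          degree_mult_le[of X "X - [:A:]"] degree_mult_le[of "X * (X - [:A:])" "X - [:B:]"] by linarith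
      then have "degree (F ^ Suc e) \<le> 3 * Suc e"
        by (intro order.trans[OF degree_power_le] mult_right_mono) simp_all
      moreover have "R = [:of_int s * 2:] * F ^ Suc e"
        by (simp only: R_def of_int_poly numeral_poly) (simp add: mult.commute)
      then have "degree R \<le> degree (F ^ Suc e)" using degree_smult_le by simp
      ultimately have "degree R \<le> 3 * Suc e" by (rule order.trans[rotated])
      also have "\<dots> \<le> 2 * q + 1" by (simp add: q)
      finally show ?thesis .
    qed
    ultimately show ?thesis unfolding N_def by (rule degree_add_le)
  qed

  obtain k f g where k: "k \<noteq> 0" "N' = k * f" "V = k * g" "coprime f g" and h: "height f g \<le> height N' V"
    using reduced_fraction[of N' V] \<open>V \<noteq> 0\<close> by auto
  have "linked [:- (A + B):] [:A * B:] X P 1 f g"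
    using linked_N \<open>G \<noteq> 0\<close> k(1) by (simp add: N' V k(2,3) linked_scale)
  moreover have "int (height f g) \<le> int q + 1 + s * S"
  proof -
    have "degree (D\<^sup>2) = degree G + degree V"
      unfolding V using \<open>G \<noteq> 0\<close> \<open>V \<noteq> 0\<close> by (rule degree_mult_eq)
    then have V': "degree G + degree V = 2 * q"
      using degD \<open>D \<noteq> 0\<close> by (simp add: degree_power_eq)
    have "degree G + degree N' \<le> 2 * q + 1"
    proof (cases "N' = 0")
      case False
      with \<open>G \<noteq> 0\<close> degN show ?thesis by (simp add: N' degree_mult_eq)
    qed (use V' in simp)
    with V' have "degree G + height N' V \<le> 2 * q + 1" by (simp add: height_def)
    with h degG show ?thesis by linarith
  qed
  ultimately show ?thesis
    using k(4) that unfolding X_def P_def q_def by blast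
qed

text \<open>
  The two signs in \<open>first_step\<close> yield chains in both directions from the Frobenius point, and hence
  nonnegativity of \<open>n\<^sup>2 + S * n + q\<close> for all integers \<open>n\<close>, where \<open>S\<close> is the character sum.
\<close>

theorem hasse_bound_cubic:
  fixes A B :: "'a::{finite_field,field_gcd}"
  assumes "odd CARD('a)"
  shows "(\<Sum>x\<in>UNIV. quad_char (x * (x - A) * (x - B)))\<^sup>2 \<le> 4 * int CARD('a)"
proof -
  let ?S = "\<Sum>x\<in>UNIV. quad_char (x * (x - A) * (x - B))"
  have height: "height (monom 1 CARD('a) :: 'a poly) 1 = CARD('a)"
    by (simp add: height_def degree_monom_eq)
  have nonneg: "0 \<le> int CARD('a) + int n * (s * ?S) + (int n)\<^sup>2" if "s = 1 \<or> s = - 1" for s n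
  proof -
    obtain f g where "coprime f g"
      "linked [:- (A + B):] [:A * B:] [:0, 1:] (monom 1 CARD('a)) 1 f g"
      "int (height f g) \<le> int CARD('a) + 1 + s * ?S"
      using first_step[OF assms \<open>s = 1 \<or> s = - 1\<close>] by blast
    then show ?thesis using linked_chain[of "monom 1 CARD('a)" 1 f g] by (simp add: height)
  qed
  show ?thesis
    using assms nonneg[of 1] nonneg[of "- 1"] by (intro discriminant_bound) simp_all
qed

section \<open>The sum over residues modulo a prime\<close>

lemma of_int_mod_ring_eq_iff:
  "(of_int x :: 'p::prime_card mod_ring) = of_int y \<longleftrightarrow> [x = y] (mod int CARD('p))"
  unfolding cong_def by transfer simp

lemma Legendre_eq_quad_char:
  "Legendre a (int CARD('p)) = quad_char (of_int a :: 'p::prime_card mod_ring)"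
proof -
  have zero: "[a = 0] (mod int CARD('p)) \<longleftrightarrow> (of_int a :: 'p mod_ring) = 0"
    using of_int_mod_ring_eq_iff[of a 0, where 'p = 'p] by simp
  have "QuadRes (int CARD('p)) a \<longleftrightarrow> (\<exists>y :: int. (of_int y :: 'p mod_ring)\<^sup>2 = of_int a)"
    unfolding QuadRes_def of_int_mod_ring_eq_iff[symmetric] by simp
  also have "\<dots> \<longleftrightarrow> (\<exists>y :: 'p mod_ring. y\<^sup>2 = of_int a)"
  proof
    assume "\<exists>y :: 'p mod_ring. y\<^sup>2 = of_int a"
    then obtain y :: "'p mod_ring" where "y\<^sup>2 = of_int a" ..
    moreover have "y = of_int (to_int_mod_ring y)" by (simp add: of_int_of_int_mod_ring)
    ultimately have "(of_int (to_int_mod_ring y) :: 'p mod_ring)\<^sup>2 = of_int a" by simp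
    then show "\<exists>y :: int. (of_int y :: 'p mod_ring)\<^sup>2 = of_int a" ..
  qed blast
  finally show ?thesis by (simp add: Legendre_def quad_char_def zero)
qed

lemma K_bound_prime_card:
  fixes A B :: int
  assumes "CARD('p::prime_card) > 2" "\<not> [A = B] (mod int CARD('p))"
  shows "(K CARD('p) A B + 1)\<^sup>2 \<le> 4 * int CARD('p)"
proof -
  let ?a = "of_int A :: 'p mod_ring" and ?b = "of_int B :: 'p mod_ring"
  have odd: "odd CARD('p mod_ring)"
    using assms(1) prime_card[where 'a = 'p] prime_odd_nat by auto
  have neq: "?a \<noteq> ?b" using assms(2) by (simp add: of_int_mod_ring_eq_iff)
  have "K CARD('p) A B = (\<Sum>z\<in>{0..<int CARD('p)}. quad_char (((of_int z)\<^sup>2 - ?a) * ((of_int z)\<^sup>2 - ?b)))"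
    unfolding K_def by (simp add: Legendre_eq_quad_char)
  also have "\<dots> = (\<Sum>x\<in>UNIV. quad_char ((x\<^sup>2 - ?a) * (x\<^sup>2 - ?b)))"
    by (rule sum.reindex_bij_witness[of _ to_int_mod_ring of_int])
      (use range_to_int_mod_ring[where 'a = 'p] in \<open>auto simp: of_int_of_int_mod_ring\<close>)
  finally have "K CARD('p) A B + 1 = (\<Sum>x\<in>UNIV. quad_char (x * (x - ?a) * (x - ?b)))"
    using sum_quartic_eq_sum_cubic[OF odd neq] by simp
  then show ?thesis using hasse_bound_cubic[OF odd, of ?a ?b] by simp
qed

definition counterexample :: "nat \<Rightarrow> bool" where
  "counterexample l \<longleftrightarrow> prime l \<and> l > 2 \<and>
     (\<exists>A B. \<not> [A = B] (mod int l) \<and> (K l A B + 1)\<^sup>2 > 4 * int l)"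

text \<open>
  The bound is now known for every prime that is the cardinality of a type. The prime in the theorem is
  a variable, and a type cannot depend on it. A type may depend on a constant, however, and a constant
  may be chosen to be a counterexample if there is one. The value 3 in the other case only serves to make the
  constant a prime.
\<close>

definition critical_prime :: nat where
  "critical_prime = (if \<exists>l. counterexample l then SOME l. counterexample l else 3)"

lemma counterexample_critical_prime:
  assumes "counterexample l"
  shows "counterexample critical_prime"
proof -
  have ex: "\<exists>l. counterexample l" using assms ..
  show ?thesis unfolding critical_prime_def if_P[OF ex] by (rule someI_ex[OF ex])
qed

lemma prime_critical_prime: "prime critical_prime"
proof (cases "\<exists>l. counterexample l")
  case True
  then obtain l where "counterexample l" ..
  then have "counterexample critical_prime" by (rule counterexample_critical_prime)
  then show ?thesis by (simp add: counterexample_def)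
next
  case False
  then show ?thesis by (simp add: critical_prime_def)
qed

typedef critical_index = "{..<critical_prime}"
  using prime_gt_0_nat[OF prime_critical_prime] by auto

lemma CARD_critical_index: "CARD(critical_index) = critical_prime"
  using type_definition.card[OF type_definition_critical_index] by simp

instance critical_index :: prime_card
  by standard (simp add: CARD_critical_index prime_critical_prime)

lemma no_counterexample: "\<not> counterexample l"
proof
  assume "counterexample l"
  then have "counterexample critical_prime" by (rule counterexample_critical_prime)
  then obtain A B where "critical_prime > 2" "\<not> [A = B] (mod int critical_prime)"
    and large: "(K critical_prime A B + 1)\<^sup>2 > 4 * int critical_prime"
    unfolding counterexample_def by blast
  then have "(K critical_prime A B + 1)\<^sup>2 \<le> 4 * int critical_prime"
    using K_bound_prime_card[where 'p = critical_index, of A B, unfolded CARD_critical_index] by blast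
  with large show False by linarith
qed

theorem corollary5p2:
  fixes l :: nat and A B :: int
  assumes "prime l" and "l > 2"
    and "\<not> [A = 0] (mod int l)"
    and "\<not> [B = 0] (mod int l)"
    and "\<not> [A = B] (mod int l)"
  shows "\<bar>real_of_int (K l A B) + 1\<bar> \<le> 2 * sqrt (real l)"
proof -
  have "(K l A B + 1)\<^sup>2 \<le> 4 * int l"
    using assms no_counterexample[of l] unfolding counterexample_def by (meson not_le)
  then have "real_of_int ((K l A B + 1)\<^sup>2) \<le> real_of_int (4 * int l)"
    by (simp only: of_int_le_iff)
  then have "\<bar>real_of_int (K l A B) + 1\<bar> \<le> sqrt (4 * real l)"
    by (intro real_le_rsqrt) simp
  then show ?thesis by (simp add: real_sqrt_mult)
qed

end
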